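(* Let $\mathcal{H}$ be a Hilbert space, let $I$ be $\mathbb{N}$ or $\mathbb{Z}$, and let $\{f_n\}_{n\in I}\subseteq\mathcal{H}$. Then $\{f_n\}_{n\in I}$ does frame reconstruction if and only if there is a dense subspace $D\subseteq\mathcal{H}$ such that the map $S:D\to\mathcal{H}$, $$Sf=\sum_{n\in I}\langle f,f_n\rangle f_n,$$ is defined (i.e. the series converges in norm for every $f\in D$), closed (as an operator with domain $D$), and surjective, where the sum is the limit of the partial sums $\sum_{n=0}^{M}$ if $I=\mathbb{N}$ and of the symmetric partial sums $\sum_{n=-M}^{M}$ if $I=\mathbb{Z}$.
   Context: $B(\mathcal{H})$ is the space of bounded linear operators on $\mathcal{H}$; inner products are linear in the first variable; $\mathbb{N}=\{0,1,2,\dots\}$. A sequence $\{f_n\}_{n\in I}\subseteq\mathcal{H}$ ($I=\mathbb{N}$ or $\mathbb{Z}$) does frame reconstruction if there is $B\in B(\mathcal{H})$ such that for every $f\in\mathcal{H}$ one has $\sum_{n=0}^{\infty}\langle f,Bf_n\rangle f_n=f$ when $I=\mathbb{N}$, respectively $\lim_{M\to\infty}\sum_{n=-M}^{M}\langle f,Bf_n\rangle f_n=f$ when $I=\mathbb{Z}$, with convergence in norm (unconditional convergence is not assumed). *)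

theory Defs
  imports "HOL-Analysis.Analysis"
begin

text \<open>
  The scalar field is the real or the complex numbers. The two axioms force this: they make
  every scalar a root of a monic real quadratic polynomial.
\<close>

class real_or_complex = real_normed_field +
  fixes scalar_conj :: "'a \<Rightarrow> 'a"
  assumes scalar_conj_add: "scalar_conj (a + b) = scalar_conj a + scalar_conj b"
    and mult_scalar_conj: "a * scalar_conj a = (norm a)\<^sup>2 *\<^sub>R 1"

instantiation real :: real_or_complex
begin

definition scalar_conj_real :: "real \<Rightarrow> real" where
  "scalar_conj_real a = a"

instance
  by standard (simp_all add: scalar_conj_real_def power2_eq_square)

end

instantiation complex :: real_or_complex
begin

definition scalar_conj_complex :: "complex \<Rightarrow> complex" where
  "scalar_conj_complex a = cnj a"

instance
  by standard (simp_all add: scalar_conj_complex_def complex_norm_square scaleR_conv_of_real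
      del: of_real_power)

end

text \<open>
  The library has no inner products with values in the complex numbers. The norm and the
  completeness are those of the type \<open>'h\<close>; positive definiteness of the inner product is
  contained in \<open>ip_self\<close>.
\<close>

locale hilbert_space = vector_space smul
  for smul :: "'k::real_or_complex \<Rightarrow> 'h::banach \<Rightarrow> 'h" +
  fixes ip :: "'h \<Rightarrow> 'h \<Rightarrow> 'k"
  assumes smul_of_real: "smul (of_real r) x = r *\<^sub>R x"
    and ip_add_left: "ip (x + y) z = ip x z + ip y z"
    and ip_smul_left: "ip (smul c x) y = c * ip x y"
    and ip_conj: "ip y x = scalar_conj (ip x y)"
    and ip_self: "ip x x = of_real ((norm x)\<^sup>2)"

lemma hilbert_space_real_inner:
  "hilbert_space scaleR (inner :: 'h::{real_inner, banach} \<Rightarrow> 'h \<Rightarrow> real)"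
  by unfold_locales
    (simp_all add: algebra_simps inner_add_left inner_commute scalar_conj_real_def
      power2_norm_eq_inner)

lemma hilbert_space_complex:
  "hilbert_space (*) (\<lambda>x y. x * cnj y :: complex)"
  by unfold_locales
    (simp_all add: algebra_simps scaleR_conv_of_real scalar_conj_complex_def
      complex_norm_square del: of_real_power)

definition bounded_operator :: "('k \<Rightarrow> 'h \<Rightarrow> 'h) \<Rightarrow> ('h::real_normed_vector \<Rightarrow> 'h) \<Rightarrow> bool" where
  "bounded_operator smul B \<longleftrightarrow>
     bounded_linear B \<and> (\<forall>c x. B (smul c x) = smul c (B x))"

text \<open>
  Both index sets are sets of integers, so that one formula covers both kinds of partial
  sums; values of \<open>a\<close> outside \<open>I\<close> play no role.
\<close>

definition partial_sum :: "int set \<Rightarrow> (int \<Rightarrow> 'h::comm_monoid_add) \<Rightarrow> nat \<Rightarrow> 'h" where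
  "partial_sum I a M = (\<Sum>n\<in>I \<inter> {- int M..int M}. a n)"

lemma partial_sum_Nats: "partial_sum \<nat> a M = (\<Sum>n=0..M. a (int n))"
proof -
  have "\<nat> \<inter> {- int M..int M} = int ` {0..M}"
    by (auto simp: Nats_altdef1 image_iff intro!: bexI[of _ "nat _"])
  then show ?thesis
    by (simp add: partial_sum_def sum.reindex)
qed

lemma partial_sum_Ints: "partial_sum \<int> a M = (\<Sum>n=- int M..int M. a n)"
proof -
  have "(\<int> :: int set) = UNIV"
    by (auto intro: Ints_of_int[where 'a = int, simplified])
  then show ?thesis
    by (simp add: partial_sum_def)
qed

definition frame_reconstruction ::
  "('k \<Rightarrow> 'h \<Rightarrow> 'h) \<Rightarrow> ('h \<Rightarrow> 'h \<Rightarrow> 'k) \<Rightarrow> int set \<Rightarrow> (int \<Rightarrow> 'h::real_normed_vector) \<Rightarrow> bool" where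
  "frame_reconstruction smul ip I f \<longleftrightarrow>
     (\<exists>B. bounded_operator smul B \<and>
       (\<forall>x. partial_sum I (\<lambda>n. smul (ip x (B (f n))) (f n)) \<longlonglongrightarrow> x))"

definition frame_series_converges ::
  "('k \<Rightarrow> 'h \<Rightarrow> 'h) \<Rightarrow> ('h \<Rightarrow> 'h \<Rightarrow> 'k) \<Rightarrow> int set \<Rightarrow> (int \<Rightarrow> 'h::real_normed_vector) \<Rightarrow> 'h \<Rightarrow> bool" where
  "frame_series_converges smul ip I f x \<longleftrightarrow>
     convergent (partial_sum I (\<lambda>n. smul (ip x (f n)) (f n)))"

text \<open>Meaningful only at points where the series converges.\<close>

definition frame_operator ::
  "('k \<Rightarrow> 'h \<Rightarrow> 'h) \<Rightarrow> ('h \<Rightarrow> 'h \<Rightarrow> 'k) \<Rightarrow> int set \<Rightarrow> (int \<Rightarrow> 'h::real_normed_vector) \<Rightarrow> 'h \<Rightarrow> 'h" where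
  "frame_operator smul ip I f x =
     lim (partial_sum I (\<lambda>n. smul (ip x (f n)) (f n)))"

definition closed_operator :: "'h set \<Rightarrow> ('h::topological_space \<Rightarrow> 'h) \<Rightarrow> bool" where
  "closed_operator D T \<longleftrightarrow> closed {(x, T x) | x. x \<in> D}"

end

theory Submission
  imports Defs
begin

text \<open>
  If \<open>B\<close> reconstructs, then applying \<open>B\<close> to the expansions of two vectors shows that \<open>B\<close> is
  symmetric, so the expansion of \<open>x\<close> is the series \<open>S (B x)\<close>; hence \<open>S\<close> restricted to the range
  of \<open>B\<close> is the inverse of a bounded operator. The range is dense, because a vector orthogonal
  to it has only zero coefficients in its expansion. Conversely, \<open>S\<close> is symmetric, so a
  surjective \<open>S\<close> is injective, and its inverse is everywhere defined and symmetric, hence bounded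
  by the Hellinger--Toeplitz theorem; this inverse is the operator that reconstructs.
\<close>

section \<open>Boundedness of linear maps from the Baire category theorem\<close>

lemma bounded_linear_if_closed_sublevels:
  fixes T :: "'a::banach \<Rightarrow> 'b::real_normed_vector"
  assumes T: "linear T" and cl: "\<And>n. closed {x. norm (T x) \<le> real n}"
  shows "bounded_linear T"
proof -
  interpret T: linear T by fact
  define A where "A n = {x. norm (T x) \<le> real n}" for n
  have "\<exists>n. interior (A n) \<noteq> {}"
  proof (rule ccontr)
    assume "\<not> ?thesis"
    \<comment> \<open>By Baire, closed sets with empty interior have a countable union with empty
      interior. The sublevel sets, however, exhaust the space, since each \<open>norm (T x)\<close>
      lies below some natural number.\<close>
    then have "Met_TC.mtopology interior_of \<Union>(range A) = {}"
      by (intro Met_TC.metric_Baire_category_alt)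
        (use cl in \<open>auto simp: A_def complete_UNIV interior_of_def interior_def\<close>)
    moreover have "\<Union>(range A) = (UNIV :: 'a set)"
      by (auto simp: A_def real_arch_simple)
    ultimately show False
      using interior_of_topspace[of "euclidean :: 'a topology"] by simp
  qed
  then obtain n y r where r: "r > 0" and sub: "ball y r \<subseteq> A n"
    by (meson all_not_in_conv mem_interior)
  have "norm (T x) \<le> norm x * (4 * real n / r)" for x
  proof (cases "x = 0")
    case False
    \<comment> \<open>The vector \<open>c *\<^sub>R x\<close> has length \<open>r / 2\<close>, so
      adding it to \<open>y\<close> stays inside the ball. Its image is then a difference of two
      vectors of norm at most \<open>n\<close>.\<close>
    define c where "c = r / (2 * norm x)"
    have c: "c > 0" "norm (c *\<^sub>R x) < r"
      using False r by (auto simp: c_def)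
    then have "y + c *\<^sub>R x \<in> A n" "y \<in> A n"
      using sub r by (auto simp: dist_norm subset_iff)
    then have "norm (T (y + c *\<^sub>R x) - T y) \<le> 2 * real n"
      using norm_triangle_ineq4[of "T (y + c *\<^sub>R x)" "T y"] by (simp add: A_def)
    then have "c * norm (T x) \<le> 2 * real n"
      using c by (simp add: T.add T.scaleR)
    then show ?thesis
      using False r by (simp add: c_def field_simps)
  qed (simp add: T.zero)
  then show ?thesis
    by (intro bounded_linear_intro[where K = "4 * real n / r"] T.add T.scaleR)
qed

section \<open>Conjugation of scalars\<close>

lemma scalar_conj_0 [simp]: "scalar_conj (0::'k::real_or_complex) = 0"
  using scalar_conj_add[of "0::'k" 0] by simp

lemma norm_scalar_conj [simp]: "norm (scalar_conj (a::'k::real_or_complex)) = norm a"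
  using arg_cong[OF mult_scalar_conj[of a], of norm]
  by (cases "a = 0") (simp_all add: norm_mult power2_eq_square)

text \<open>Multiplied by \<open>a * b\<close>, both sides become squared norms, which agree because
  the norm is multiplicative; a nonzero \<open>a * b\<close> can then be cancelled.\<close>

lemma scalar_conj_mult: "scalar_conj (a * b :: 'k::real_or_complex) = scalar_conj a * scalar_conj b"
proof (cases "a * b = 0")
  case False
  have "(a * b) * scalar_conj (a * b) = (a * scalar_conj a) * (b * scalar_conj b)"
    by (simp only: mult_scalar_conj) (simp add: norm_mult power_mult_distrib)
  then have "(a * b) * scalar_conj (a * b) = (a * b) * (scalar_conj a * scalar_conj b)"
    by (simp add: mult_ac)
  with False show ?thesis by simp
qed auto

lemma scalar_conj_of_real: "scalar_conj (of_real r :: 'k::real_or_complex) = of_real r"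
  using mult_scalar_conj[of "of_real r :: 'k"]
  by (cases "r = 0") (auto simp: scaleR_conv_of_real power2_eq_square)

context hilbert_space
begin

section \<open>Algebra and continuity of the inner product\<close>

lemma ip_add_right: "ip x (y + z) = ip x y + ip x z"
  by (metis ip_add_left ip_conj scalar_conj_add)

lemma ip_smul_right: "ip x (smul c y) = scalar_conj c * ip x y"
  by (metis ip_conj ip_smul_left scalar_conj_mult)

lemma ip_zero_left [simp]: "ip 0 x = 0"
  using ip_add_left[of 0 0 x] by simp

lemma ip_minus_left: "ip (- x) y = - ip x y"
  using ip_add_left[of x "- x" y] by (simp add: eq_neg_iff_add_eq_0 add.commute)

lemma ip_diff_left: "ip (x - y) z = ip x z - ip y z"
  using ip_add_left[of x "- y" z] by (simp add: ip_minus_left)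

lemma ip_diff_right: "ip x (y - z) = ip x y - ip x z"
  by (metis ip_add_right add_diff_cancel diff_add_cancel)

lemma ip_self_eq_0: "ip x x = 0 \<longleftrightarrow> x = 0"
  by (simp add: ip_self)

lemma ip_right_cancel: "(\<And>z. ip x z = ip y z) \<Longrightarrow> x = y"
  using ip_self_eq_0[of "x - y"] by (simp add: ip_diff_left)

text \<open>This quadratic in the real parameter \<open>t\<close> is used twice: its minimum gives
  the Cauchy-Schwarz inequality, and its behaviour for small positive \<open>t\<close> gives
  orthogonality at a nearest point.\<close>

lemma norm_diff_smul_ip:
  "(norm (x - smul (of_real t * ip x y) y))\<^sup>2 =
    (norm x)\<^sup>2 - 2 * t * (norm (ip x y))\<^sup>2 + t\<^sup>2 * (norm (ip x y))\<^sup>2 * (norm y)\<^sup>2"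
  (is "?l = ?r")
proof -
  have yx: "ip x y * ip y x = of_real ((norm (ip x y))\<^sup>2)"
    by (simp add: ip_conj[of y x] mult_scalar_conj scaleR_conv_of_real)
  have "of_real ?l = ip x x - of_real t * (ip x y * ip y x) - of_real t * (ip x y * ip y x)
      + (of_real t)\<^sup>2 * (ip x y * ip y x) * ip y y"
    unfolding ip_self[symmetric]
    by (simp add: ip_diff_left ip_diff_right ip_smul_left ip_smul_right scalar_conj_mult
        scalar_conj_of_real ip_conj[symmetric] algebra_simps power2_eq_square)
  also have "\<dots> = (of_real ?r :: 'k)"
    unfolding yx ip_self by simp
  finally show ?thesis
    by (simp only: of_real_eq_iff)
qed

lemma ip_Cauchy_Schwarz: "norm (ip x y) \<le> norm x * norm y"
proof (cases "y = 0")
  case False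
  \<comment> \<open>The quadratic in \<open>norm_diff_smul_ip\<close> attains its minimum at this
    \<open>t\<close>, so its nonnegativity says the most here.\<close>
  define t where "t = 1 / (norm y)\<^sup>2"
  have t: "t * (norm y)\<^sup>2 = 1"
    using False by (simp add: t_def)
  have "0 \<le> (norm x)\<^sup>2 - 2 * t * (norm (ip x y))\<^sup>2 + t\<^sup>2 * (norm (ip x y))\<^sup>2 * (norm y)\<^sup>2"
    by (simp flip: norm_diff_smul_ip)
  also have "t\<^sup>2 * (norm (ip x y))\<^sup>2 * (norm y)\<^sup>2 = t * (norm (ip x y))\<^sup>2 * (t * (norm y)\<^sup>2)"
    by (simp add: power2_eq_square)
  finally have "t * (norm (ip x y))\<^sup>2 \<le> (norm x)\<^sup>2"
    unfolding t by simp
  then have "(norm (ip x y))\<^sup>2 \<le> (norm x * norm y)\<^sup>2"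
    using False by (simp add: t_def field_simps power_mult_distrib)
  then show ?thesis
    by (rule power2_le_imp_le) simp
next
  case True
  then show ?thesis by (simp add: ip_conj[of _ 0])
qed

lemma scaleR_smul: "r *\<^sub>R x = smul (of_real r) x"
  by (simp add: smul_of_real)

text \<open>Conjugate linearity in the second argument is still real linearity, because conjugation
  fixes real scalars. The rules for limits and sums of real bilinear maps thus apply.\<close>

lemma bounded_bilinear_ip: "bounded_bilinear ip"
proof (rule bounded_bilinear.intro)
  show "\<exists>K. \<forall>a b. norm (ip a b) \<le> norm a * norm b * K"
    using ip_Cauchy_Schwarz by (intro exI[of _ 1]) simp
qed (simp_all add: ip_add_left ip_add_right scaleR_smul ip_smul_left ip_smul_right
      scalar_conj_of_real scaleR_conv_of_real)

lemmas tendsto_ip [tendsto_intros] = bounded_bilinear.tendsto[OF bounded_bilinear_ip]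

lemmas ip_sum_left = bounded_bilinear.sum_left[OF bounded_bilinear_ip]

lemmas ip_sum_right = bounded_bilinear.sum_right[OF bounded_bilinear_ip]

text \<open>The identity \<open>norm (smul c y) = norm c * norm y\<close> follows from
  \<open>ip_self\<close> and makes \<open>smul c\<close> a bounded real-linear map.\<close>

lemma tendsto_smul:
  assumes "(X \<longlongrightarrow> x) F"
  shows "((\<lambda>n. smul c (X n)) \<longlongrightarrow> smul c x) F"
proof -
  have "norm (smul c y) = norm c * norm y" for y
  proof -
    have "of_real ((norm (smul c y))\<^sup>2) = (of_real ((norm c * norm y)\<^sup>2) :: 'k)"
      unfolding ip_self[symmetric] ip_smul_left ip_smul_right mult.assoc[symmetric]
      by (simp add: ip_self mult_scalar_conj mult.commute[of "scalar_conj c"] scaleR_conv_of_real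
          power_mult_distrib)
    then show ?thesis
      by (simp only: of_real_eq_iff) (simp add: power2_eq_iff_nonneg)
  qed
  then have "bounded_linear (smul c)"
    by (intro bounded_linear_intro[where K = "norm c"])
      (simp_all add: scale_right_distrib scaleR_smul mult.commute)
  from bounded_linear.tendsto[OF this assms] show ?thesis .
qed

section \<open>Nearest points and density\<close>

lemma parallelogram_law:
  fixes x y :: 'h
  shows "(norm (x + y))\<^sup>2 + (norm (x - y))\<^sup>2 = 2 * (norm x)\<^sup>2 + 2 * (norm y)\<^sup>2"
proof -
  have "of_real ((norm (x + y))\<^sup>2 + (norm (x - y))\<^sup>2) =
      (of_real (2 * (norm x)\<^sup>2 + 2 * (norm y)\<^sup>2) :: 'k)"
    unfolding of_real_add of_real_mult ip_self[symmetric]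
    by (simp add: ip_add_left ip_add_right ip_diff_left ip_diff_right)
  then show ?thesis by (simp only: of_real_eq_iff)
qed

text \<open>The midpoint of two members of \<open>M\<close> is again at distance at least
  \<open>d\<close> from \<open>z\<close>, so the parallelogram law leaves little room for their
  difference.\<close>

lemma minimizing_sequence_Cauchy:
  fixes d :: real
  assumes M: "subspace M" and m: "\<And>k. m k \<in> M" and lower: "\<And>y. y \<in> M \<Longrightarrow> d \<le> norm (z - y)"
    and "d \<ge> 0" and lim: "(\<lambda>k. norm (z - m k)) \<longlonglongrightarrow> d"
  shows "Cauchy m"
proof (rule metric_CauchyI)
  fix e :: real assume e: "e > 0"
  have "(\<lambda>k. (norm (z - m k))\<^sup>2) \<longlonglongrightarrow> d\<^sup>2"
    by (intro tendsto_intros lim)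
  \<comment> \<open>In the parallelogram law the two squared distances are doubled, giving a
    right-hand side below \<open>4 * d\<^sup>2 + e\<^sup>2\<close>; the midpoint bound accounts for
    \<open>4 * d\<^sup>2\<close> of it.\<close>
  then obtain N where N: "\<And>k. k \<ge> N \<Longrightarrow> (norm (z - m k))\<^sup>2 < d\<^sup>2 + e\<^sup>2 / 4"
    using e order_tendstoD(2)[of _ "d\<^sup>2" sequentially "d\<^sup>2 + e\<^sup>2 / 4"]
    by (auto simp: eventually_sequentially)
  have "dist (m k) (m l) < e" if "k \<ge> N" "l \<ge> N" for k l
  proof -
    have "(1/2) *\<^sub>R (m k + m l) \<in> M"
      unfolding scaleR_smul using M m by (intro subspace_scale subspace_add)
    then have "d \<le> norm (z - (1/2) *\<^sub>R (m k + m l))"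
      by (rule lower)
    also have "z - (1/2) *\<^sub>R (m k + m l) = (1/2) *\<^sub>R ((z - m k) + (z - m l))"
      by (simp add: algebra_simps flip: scaleR_add_left)
    finally have "2 * d \<le> norm ((z - m k) + (z - m l))"
      by simp
    then have "(2 * d)\<^sup>2 \<le> (norm ((z - m k) + (z - m l)))\<^sup>2"
      using \<open>d \<ge> 0\<close> by (intro power_mono) auto
    with parallelogram_law[of "z - m k" "z - m l"] N[OF that(1)] N[OF that(2)]
    have "(norm (m l - m k))\<^sup>2 < e\<^sup>2"
      by (simp add: power_mult_distrib)
    then show ?thesis
      using e by (simp add: dist_norm norm_minus_commute power_less_imp_less_base)
  qed
  then show "\<exists>N. \<forall>k\<ge>N. \<forall>l\<ge>N. dist (m k) (m l) < e"
    by blast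
qed

text \<open>A sequence in \<open>M\<close> minimising the distance to \<open>z\<close> has a limit
  \<open>p\<close> with \<open>z - p\<close> orthogonal to \<open>M\<close>. Hence
  \<open>z = p\<close>, a limit of points of \<open>M\<close>.\<close>

lemma dense_if_orthogonal_trivial:
  assumes M: "subspace M" and orth: "\<And>w. (\<And>y. y \<in> M \<Longrightarrow> ip w y = 0) \<Longrightarrow> w = 0"
  shows "closure M = UNIV"
proof (intro set_eqI iffI UNIV_I)
  fix z
  define d where "d = infdist z M"
  have ne: "M \<noteq> {}"
    using M subspace_0 by blast
  have lower: "d \<le> norm (z - y)" if "y \<in> M" for y
    using that by (simp add: d_def infdist_le flip: dist_norm)
  have "d \<ge> 0"
    by (simp add: d_def infdist_nonneg)
  have "\<exists>y\<in>M. norm (z - y) < d + 1 / Suc k" for k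
    using cINF_less_iff[of M "dist z" "d + 1 / Suc k"] ne
    by (auto simp: d_def infdist_notempty simp flip: dist_norm intro!: bdd_belowI2[of _ 0])
  then obtain m where m: "\<And>k. m k \<in> M" and up: "\<And>k. norm (z - m k) < d + 1 / Suc k"
    by metis
  have lim: "(\<lambda>k. norm (z - m k)) \<longlonglongrightarrow> d"
  proof (rule tendsto_sandwich[of "\<lambda>_. d" _ _ "\<lambda>k. d + 1 / Suc k"])
    show "(\<lambda>k. d + 1 / Suc k) \<longlonglongrightarrow> d"
      using tendsto_add[OF tendsto_const LIMSEQ_inverse_real_of_nat, of d]
      by (simp add: inverse_eq_divide)
  qed (use m lower up in \<open>auto intro!: always_eventually less_imp_le simp del: of_nat_Suc\<close>)
  have "Cauchy m"
    using M m lower \<open>d \<ge> 0\<close> lim by (rule minimizing_sequence_Cauchy)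
  then obtain p where p: "m \<longlonglongrightarrow> p"
    using Cauchy_convergent_iff convergent_def by blast
  have "norm (z - p) = d"
    using LIMSEQ_unique[OF tendsto_norm[OF tendsto_diff[OF tendsto_const p]] lim] .
  \<comment> \<open>The limit \<open>p\<close> may lie outside \<open>M\<close>, so the bound is
    obtained for \<open>m k + y\<close>, which lies in \<open>M\<close>, and then passed to the
    limit.\<close>
  have min: "norm (z - p) \<le> norm (z - p - y)" if "y \<in> M" for y
  proof (rule Lim_bounded2[where N = 0])
    show "(\<lambda>k. norm (z - m k - y)) \<longlonglongrightarrow> norm (z - p - y)"
      by (intro tendsto_intros p)
    show "\<forall>k\<ge>0. norm (z - p) \<le> norm (z - m k - y)"
      using lower[OF subspace_add[OF M m that]] \<open>norm (z - p) = d\<close> by (simp add: algebra_simps)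
  qed
  have "ip (z - p) y = 0" if "y \<in> M" for y
  proof -
    \<comment> \<open>The quadratic falls below its value at \<open>t = 0\<close> for small positive
      \<open>t\<close> unless \<open>ip (z - p) y = 0\<close>. The summand \<open>1\<close> keeps
      the denominator positive when \<open>y = 0\<close>.\<close>
    define t where "t = 1 / ((norm y)\<^sup>2 + 1)"
    have t: "t > 0" "t * (norm y)\<^sup>2 < 1"
      unfolding t_def by (auto simp: add_nonneg_pos)
    have "smul (of_real t * ip (z - p) y) y \<in> M"
      using M that by (rule subspace_scale)
    from power_mono[OF min[OF this] norm_ge_zero, of 2]
    have "0 \<le> - 2 * t * (norm (ip (z - p) y))\<^sup>2 + t\<^sup>2 * (norm (ip (z - p) y))\<^sup>2 * (norm y)\<^sup>2"
      unfolding norm_diff_smul_ip by simp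
    also have "\<dots> = t * (norm (ip (z - p) y))\<^sup>2 * (t * (norm y)\<^sup>2 - 2)"
      by (simp add: power2_eq_square algebra_simps)
    finally show ?thesis
      using t by (auto simp: zero_le_mult_iff mult_le_0_iff)
  qed
  then have "z - p = 0"
    by (rule orth)
  then have "m \<longlonglongrightarrow> z"
    using p by simp
  with m show "z \<in> closure M"
    unfolding closure_sequential by blast
qed

section \<open>The Hellinger--Toeplitz theorem\<close>

lemma symmetric_imp_bounded_operator:
  assumes lin: "\<And>x y. C (x + y) = C x + C y" "\<And>c x. C (smul c x) = smul c (C x)"
    and sym: "\<And>x y. ip (C x) y = ip x (C y)"
  shows "bounded_operator smul C"
proof -
  have "linear C"
    by (intro linearI) (simp_all add: lin scaleR_smul)
  moreover have "closed {x. norm (C x) \<le> real n}" for n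
  proof (unfold closed_sequential_limits, intro allI impI, elim conjE)
    fix X x assume X: "\<forall>k. X k \<in> {x. norm (C x) \<le> real n}" "X \<longlonglongrightarrow> x"
    \<comment> \<open>Continuity of \<open>C\<close> is not yet available, but symmetry shifts it to
      the fixed argument: the terms equal \<open>ip (X k) (C (C x))\<close>, which converge with
      \<open>X\<close>.\<close>
    have "(\<lambda>k. ip (C (X k)) (C x)) \<longlonglongrightarrow> ip (C x) (C x)"
      unfolding sym by (intro tendsto_intros X)
    then have lim: "(\<lambda>k. norm (ip (C (X k)) (C x))) \<longlonglongrightarrow> norm (ip (C x) (C x))"
      by (rule tendsto_norm)
    have "norm (ip (C (X k)) (C x)) \<le> real n * norm (C x)" for k
      using ip_Cauchy_Schwarz[of "C (X k)" "C x"] X(1)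
      by (smt (verit) mem_Collect_eq mult_right_mono norm_ge_zero)
    then have "norm (ip (C x) (C x)) \<le> real n * norm (C x)"
      by (intro LIMSEQ_le_const2[OF lim]) auto
    then have "norm (C x) * norm (C x) \<le> real n * norm (C x)"
      by (simp add: ip_self power2_eq_square norm_mult)
    then show "x \<in> {x. norm (C x) \<le> real n}"
      by (cases "C x = 0") auto
  qed
  ultimately show ?thesis
    by (simp add: bounded_operator_def lin bounded_linear_if_closed_sublevels)
qed

section \<open>Symmetry of frame series\<close>

lemma ip_partial_sum_left:
  "ip (partial_sum I (\<lambda>n. smul (a n) (g n)) M) y = (\<Sum>n\<in>I \<inter> {- int M..int M}. a n * ip (g n) y)"
  by (simp add: partial_sum_def ip_sum_left ip_smul_left)

lemma ip_partial_sum_right: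
  "ip y (partial_sum I (\<lambda>n. smul (a n) (g n)) M) =
    (\<Sum>n\<in>I \<inter> {- int M..int M}. scalar_conj (a n) * ip y (g n))"
  by (simp add: partial_sum_def ip_sum_right ip_smul_right)

text \<open>Symmetry holds for each partial sum, since both sides are then the finite sum of the
  products \<open>ip x (f n) * ip (f n) y\<close>, and it survives the limit.\<close>

lemma frame_series_limit_symmetric:
  assumes x: "partial_sum I (\<lambda>n. smul (ip x (f n)) (f n)) \<longlonglongrightarrow> u"
    and y: "partial_sum I (\<lambda>n. smul (ip y (f n)) (f n)) \<longlonglongrightarrow> v"
  shows "ip u y = ip x v"
proof -
  have eq: "ip (partial_sum I (\<lambda>n. smul (ip x (f n)) (f n)) M) y =
      ip x (partial_sum I (\<lambda>n. smul (ip y (f n)) (f n)) M)" for M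
    by (simp add: ip_partial_sum_left ip_partial_sum_right mult.commute flip: ip_conj)
  have "(\<lambda>M. ip (partial_sum I (\<lambda>n. smul (ip x (f n)) (f n)) M) y) \<longlonglongrightarrow> ip u y"
    using x tendsto_const by (rule tendsto_ip)
  moreover have "(\<lambda>M. ip (partial_sum I (\<lambda>n. smul (ip x (f n)) (f n)) M) y) \<longlonglongrightarrow> ip x v"
    unfolding eq using tendsto_const y by (rule tendsto_ip)
  ultimately show ?thesis
    by (rule LIMSEQ_unique)
qed

text \<open>Applying \<open>B\<close> termwise to the expansion of \<open>x\<close> gives the frame
  series at \<open>x\<close> of the family \<open>B (f n)\<close>, so \<open>B\<close> is the frame
  operator of that family.\<close>

lemma reconstruction_operator_symmetric:
  assumes B: "bounded_operator smul B"
    and rec: "\<And>x. partial_sum I (\<lambda>n. smul (ip x (B (f n))) (f n)) \<longlonglongrightarrow> x"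
  shows "ip (B x) y = ip x (B y)"
proof -
  have lin: "bounded_linear B" and smul: "\<And>c x. B (smul c x) = smul c (B x)"
    using B by (auto simp: bounded_operator_def)
  have lim: "partial_sum I (\<lambda>n. smul (ip x (B (f n))) (B (f n))) \<longlonglongrightarrow> B x" for x
    using bounded_linear.tendsto[OF lin rec, of x]
    by (simp add: partial_sum_def[abs_def] linear_sum[OF bounded_linear.linear[OF lin]] smul)
  show ?thesis
    by (rule frame_series_limit_symmetric[where f = "\<lambda>n. B (f n)", OF lim lim])
qed

section \<open>From reconstruction to the frame operator on the range of \<open>B\<close>\<close>

lemma frame_reconstruction_imp_frame_operator:
  assumes "frame_reconstruction smul ip I f"
  obtains D where "subspace D" "closure D = UNIV"
    "\<forall>x\<in>D. frame_series_converges smul ip I f x"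
    "closed_operator D (frame_operator smul ip I f)"
    "frame_operator smul ip I f ` D = UNIV"
proof -
  from assms obtain B where B: "bounded_operator smul B"
    and rec: "\<And>x. partial_sum I (\<lambda>n. smul (ip x (B (f n))) (f n)) \<longlonglongrightarrow> x"
    by (auto simp: frame_reconstruction_def)
  have lin: "bounded_linear B" and smul: "\<And>c x. B (smul c x) = smul c (B x)"
    using B by (auto simp: bounded_operator_def)
  note sym = reconstruction_operator_symmetric[OF B rec]
  have lim: "partial_sum I (\<lambda>n. smul (ip (B x) (f n)) (f n)) \<longlonglongrightarrow> x" for x
    using rec[of x] by (simp add: sym)
  then have S: "frame_operator smul ip I f (B x) = x" for x
    unfolding frame_operator_def by (rule limI)
  have sub: "subspace (range B)"
  proof (rule subspaceI)
    show "0 \<in> range B"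
      using linear_0[OF bounded_linear.linear[OF lin]] by (intro image_eqI[of _ _ 0]) simp_all
    show "x + y \<in> range B" if xy: "x \<in> range B" "y \<in> range B" for x y
    proof -
      obtain a b where "x = B a" "y = B b"
        using xy by blast
      then show ?thesis
        using linear_add[OF bounded_linear.linear[OF lin], of a b]
        by (intro image_eqI[of _ _ "a + b"]) simp_all
    qed
    show "smul c x \<in> range B" if x: "x \<in> range B" for c x
    proof -
      obtain a where "x = B a"
        using x by blast
      then show ?thesis
        using smul[of c a] by (intro image_eqI[of _ _ "smul c a"]) simp_all
    qed
  qed
  have dense: "closure (range B) = UNIV"
  proof (rule dense_if_orthogonal_trivial[OF sub])
    fix w assume "\<And>y. y \<in> range B \<Longrightarrow> ip w y = 0"
    then have "partial_sum I (\<lambda>n. smul (ip w (B (f n))) (f n)) = (\<lambda>_. 0)"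
      by (auto simp: partial_sum_def)
    with rec[of w] show "w = 0"
      by (simp add: LIMSEQ_const_iff)
  qed
  have conv: "\<forall>x\<in>range B. frame_series_converges smul ip I f x"
    using lim by (auto simp: frame_series_converges_def convergent_def)
  have closed: "closed_operator (range B) (frame_operator smul ip I f)"
  proof -
    \<comment> \<open>On \<open>range B\<close> the operator is inverse to \<open>B\<close>, so its
      graph is the graph of the continuous map \<open>B\<close> with coordinates exchanged.\<close>
    have "{(x, frame_operator smul ip I f x) |x. x \<in> range B} = {p. fst p = B (snd p)}"
      by (auto simp: S)
    moreover have "closed \<dots>"
      by (intro closed_Collect_eq continuous_intros bounded_linear.continuous_on[OF lin])
    ultimately show ?thesis
      by (simp add: closed_operator_def)
  qed
  have surj: "frame_operator smul ip I f ` range B = UNIV"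
    using S by (metis UNIV_eq_I rangeI image_eqI)
  show ?thesis
    using sub dense conv closed surj by (rule that)
qed

section \<open>Reconstruction by the inverse of a surjective frame operator\<close>

lemma surjective_frame_operator_imp_frame_reconstruction:
  assumes D: "subspace D"
    and conv: "\<And>x. x \<in> D \<Longrightarrow> frame_series_converges smul ip I f x"
    and surj: "frame_operator smul ip I f ` D = UNIV"
  shows "frame_reconstruction smul ip I f"
proof -
  define S where "S = frame_operator smul ip I f"
  define P where "P x = partial_sum I (\<lambda>n. smul (ip x (f n)) (f n))" for x
  have lim: "P x \<longlonglongrightarrow> S x" if "x \<in> D" for x
    using conv[OF that] unfolding P_def S_def frame_series_converges_def frame_operator_def
    by (simp add: convergent_LIMSEQ_iff)
  have surj': "\<exists>x\<in>D. S x = y" for y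
    using surj by (metis S_def UNIV_I imageE)
  have sym: "ip (S x) y = ip x (S y)" if "x \<in> D" "y \<in> D" for x y
    using frame_series_limit_symmetric lim that unfolding P_def by blast
  \<comment> \<open>By symmetry \<open>x\<close> and \<open>y\<close> have equal inner products with
    every \<open>S w\<close> for \<open>w\<close> in \<open>D\<close>, and these vectors fill the
    space.\<close>
  have inj: "x = y" if "x \<in> D" "y \<in> D" "S x = S y" for x y
  proof (rule ip_right_cancel)
    fix z obtain w where "w \<in> D" "S w = z"
      using surj' by blast
    with that show "ip x z = ip y z"
      by (metis sym)
  qed
  have S_add: "S (x + y) = S x + S y" if "x \<in> D" "y \<in> D" for x y
  proof (rule LIMSEQ_unique)
    show "P (x + y) \<longlonglongrightarrow> S (x + y)"
      using that D by (intro lim subspace_add)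
    have "P (x + y) = (\<lambda>M. P x M + P y M)"
      by (simp add: P_def fun_eq_iff partial_sum_def ip_add_left scale_left_distrib sum.distrib)
    then show "P (x + y) \<longlonglongrightarrow> S x + S y"
      using that by (auto intro!: tendsto_intros lim)
  qed
  have S_smul: "S (smul c x) = smul c (S x)" if "x \<in> D" for c x
  proof (rule LIMSEQ_unique)
    show "P (smul c x) \<longlonglongrightarrow> S (smul c x)"
      using that D by (intro lim subspace_scale)
    have "P (smul c x) = (\<lambda>M. smul c (P x M))"
      by (simp add: P_def fun_eq_iff partial_sum_def ip_smul_left scale_sum_right)
    then show "P (smul c x) \<longlonglongrightarrow> smul c (S x)"
      using that by (auto intro!: tendsto_smul lim)
  qed
  \<comment> \<open>Preimages are merely chosen here. Injectivity makes \<open>C\<close> linear: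
    both sides of each linearity law lie in \<open>D\<close> and have the same image under
    \<open>S\<close>.\<close>
  obtain C where C: "\<And>y. C y \<in> D" "\<And>y. S (C y) = y"
    using surj' by metis
  have C_sym: "ip (C x) y = ip x (C y)" for x y
    using sym[OF C(1) C(1), of x y] by (simp only: C(2))
  have "bounded_operator smul C"
  proof (rule symmetric_imp_bounded_operator)
    show "C (x + y) = C x + C y" for x y
      by (rule inj[OF C(1) subspace_add[OF D C(1) C(1)]]) (simp only: S_add[OF C(1) C(1)] C(2))
    show "C (smul c x) = smul c (C x)" for c x
      by (rule inj[OF C(1) subspace_scale[OF D C(1)]]) (simp only: S_smul[OF C(1)] C(2))
  qed (fact C_sym)
  moreover have "partial_sum I (\<lambda>n. smul (ip x (C (f n))) (f n)) \<longlonglongrightarrow> x" for x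
    \<comment> \<open>The frame series at \<open>C x\<close> sums to \<open>S (C x) = x\<close>, and
      symmetry moves \<open>C\<close> from \<open>x\<close> to \<open>f n\<close> in its
      coefficients.\<close>
    using lim[OF C(1)[of x]] by (simp add: P_def C(2) C_sym)
  ultimately show ?thesis
    unfolding frame_reconstruction_def by (intro exI[of _ C] conjI allI)
qed

end

theorem theorem3p6:
  fixes smul :: "'k::real_or_complex \<Rightarrow> 'h::banach \<Rightarrow> 'h"
    and ip :: "'h \<Rightarrow> 'h \<Rightarrow> 'k"
    and I :: "int set"
    and f :: "int \<Rightarrow> 'h"
  assumes "hilbert_space smul ip"
    and "I = \<nat> \<or> I = \<int>"
  shows "frame_reconstruction smul ip I f \<longleftrightarrow>
    (\<exists>D. module.subspace smul D \<and> closure D = UNIV \<and>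
      (\<forall>x\<in>D. frame_series_converges smul ip I f x) \<and>
      closed_operator D (frame_operator smul ip I f) \<and>
      frame_operator smul ip I f ` D = UNIV)"
proof -
  interpret hilbert_space smul ip by fact
  show ?thesis
  proof
    assume "frame_reconstruction smul ip I f"
    then show "\<exists>D. subspace D \<and> closure D = UNIV \<and>
      (\<forall>x\<in>D. frame_series_converges smul ip I f x) \<and>
      closed_operator D (frame_operator smul ip I f) \<and>
      frame_operator smul ip I f ` D = UNIV"
      by (rule frame_reconstruction_imp_frame_operator) blast
  qed (blast intro: surjective_frame_operator_imp_frame_reconstruction)
qed

end
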